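(* Let $\mathcal{X}\subset\mathbb{R}^n$ be Clarke regular. If $\mathcal{X}$ is prox-regular with respect to a continuous ($C^0$) metric $g$, then it is prox-regular with respect to any other $C^0$ metric.
   Context: Tangent cone: for $x\in\mathcal{X}$, $T_x\mathcal{X}$ is the set of all $v\in\mathbb{R}^n$ for which there exist $x_k\in\mathcal{X}$, $x_k\to x$, and $\delta_k\to 0^+$ with $(x_k-x)/\delta_k\to v$. Clarke tangent cone: $T^C_x\mathcal{X}:=\liminf_{y\to x}T_y\mathcal{X}$, i.e. the set of $v$ such that for every sequence $x_k\in\mathcal{X}$, $x_k\to x$, there are (for all large $k$) $v_k\in T_{x_k}\mathcal{X}$ with $v_k\to v$. $\mathcal{X}$ is Clarke regular if it is locally compact (the intersection of a closed and an open subset of $\mathbb{R}^n$) and $T_x\mathcal{X}=T_x^C\mathcal{X}$ for all $x\in\mathcal{X}$. Metric: a map $g$ assigning to every $x\in\mathcal{X}$ an inner product $\langle\cdot,\cdot\rangle_{g(x)}$ on $\mathbb{R}^n$, with norm $\|\cdot\|_{g(x)}$; it is $C^0$ if it is continuous as a map from $\mathcal{X}$ into the space of bilinear forms on $\mathbb{R}^n$. Normal cone with respect to $g$: $N^g_x\mathcal{X}:=\{\eta\in\mathbb{R}^n\mid \langle v,\eta\rangle_{g(x)}\le 0\ \ \forall v\in T^C_x\mathcal{X}\}$. Prox-regularity with respect to $g$: a Clarke regular set $\mathcal{X}$ is prox-regular with respect to $g$ if for every $x\in\mathcal{X}$ there exist $L>0$ and a relative neighborhood $U\subset\mathcal{X}$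 of $x$ such that for all $y,z\in U$ and all $\eta\in N^g_y\mathcal{X}$, $$\langle\eta,z-y\rangle_{g(y)}\le L\,\|\eta\|_{g(y)}\,\|z-y\|^2_{g(y)} .$$ *)

theory Defs
  imports "HOL-Analysis.Analysis"
begin

definition tangent_cone :: "(real ^ 'n) set \<Rightarrow> real ^ 'n \<Rightarrow> (real ^ 'n) set" where
  "tangent_cone X x =
    {v. \<exists>xs \<delta>. (\<forall>k. xs k \<in> X) \<and> xs \<longlonglongrightarrow> x \<and> filterlim \<delta> (at_right 0) sequentially \<and>
          (\<lambda>k::nat. (xs k - x) /\<^sub>R \<delta> k) \<longlonglongrightarrow> v}"

definition clarke_tangent_cone :: "(real ^ 'n) set \<Rightarrow> real ^ 'n \<Rightarrow> (real ^ 'n) set" where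
  "clarke_tangent_cone X x =
    {v. \<forall>xs. (\<forall>k::nat. xs k \<in> X) \<and> xs \<longlonglongrightarrow> x \<longrightarrow>
          (\<exists>vs. (\<forall>\<^sub>F k in sequentially. vs k \<in> tangent_cone X (xs k)) \<and> vs \<longlonglongrightarrow> v)}"

definition clarke_regular :: "(real ^ 'n) set \<Rightarrow> bool" where
  "clarke_regular X \<longleftrightarrow>
    (\<exists>C W. closed C \<and> open W \<and> X = C \<inter> W) \<and>
    (\<forall>x\<in>X. tangent_cone X x = clarke_tangent_cone X x)"

text \<open>
  In finite dimension every bilinear form is bounded, so the curried type below is the space of all
  bilinear forms, topologised by the operator norm.
\<close>

type_synonym 'n bilinear_form = "(real ^ 'n) \<Rightarrow>\<^sub>L ((real ^ 'n) \<Rightarrow>\<^sub>L real)"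

definition inner_product :: "'n::finite bilinear_form \<Rightarrow> bool" where
  "inner_product b \<longleftrightarrow>
    (\<forall>u v. blinfun_apply (blinfun_apply b u) v = blinfun_apply (blinfun_apply b v) u) \<and>
    (\<forall>u. u \<noteq> 0 \<longrightarrow> blinfun_apply (blinfun_apply b u) u > 0)"

definition form_norm :: "'n::finite bilinear_form \<Rightarrow> real ^ 'n \<Rightarrow> real" where
  "form_norm b u = sqrt (blinfun_apply (blinfun_apply b u) u)"

text \<open>A metric is a total function; its values outside \<open>X\<close> are irrelevant.\<close>

definition metric_on :: "(real ^ 'n) set \<Rightarrow> (real ^ 'n \<Rightarrow> 'n::finite bilinear_form) \<Rightarrow> bool" where
  "metric_on X g \<longleftrightarrow> (\<forall>x\<in>X. inner_product (g x))"

definition C0_metric_on :: "(real ^ 'n) set \<Rightarrow> (real ^ 'n \<Rightarrow> 'n::finite bilinear_form) \<Rightarrow> bool" where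
  "C0_metric_on X g \<longleftrightarrow> metric_on X g \<and> continuous_on X g"

definition normal_cone ::
  "(real ^ 'n \<Rightarrow> 'n::finite bilinear_form) \<Rightarrow> (real ^ 'n) set \<Rightarrow> real ^ 'n \<Rightarrow> (real ^ 'n) set" where
  "normal_cone g X x =
    {\<eta>. \<forall>v\<in>clarke_tangent_cone X x. blinfun_apply (blinfun_apply (g x) v) \<eta> \<le> 0}"

definition prox_regular ::
  "(real ^ 'n) set \<Rightarrow> (real ^ 'n \<Rightarrow> 'n::finite bilinear_form) \<Rightarrow> bool" where
  "prox_regular X g \<longleftrightarrow>
    clarke_regular X \<and>
    (\<forall>x\<in>X. \<exists>L>0. \<exists>U. openin (top_of_set X) U \<and> x \<in> U \<and>
      (\<forall>y\<in>U. \<forall>z\<in>U. \<forall>\<eta>\<in>normal_cone g X y.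
        blinfun_apply (blinfun_apply (g y) \<eta>) (z - y)
          \<le> L * form_norm (g y) \<eta> * (form_norm (g y) (z - y))\<^sup>2))"

end

theory Submission
  imports Defs
begin

text \<open>
  Normal vectors with respect to \<open>g\<close> and \<open>g'\<close> at \<open>y\<close> represent the same covectors: given
  \<open>\<eta>'\<close> normal with respect to \<open>g'\<close>, the vector \<open>\<eta>\<close> with \<open>\<langle>\<eta>, \<cdot>\<rangle>\<^bsub>g\<^esub> = \<langle>\<eta>', \<cdot>\<rangle>\<^bsub>g'\<^esub>\<close> is normal
  with respect to \<open>g\<close>, so the inequality for \<open>\<eta>\<close> transfers to \<open>\<eta>'\<close>. The constant only changes
  by a bounded factor, since continuous metrics are locally uniformly equivalent.
\<close>

lemma inner_product_nonneg:
  assumes "inner_product b"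
  shows "blinfun_apply (blinfun_apply b u) u \<ge> 0"
  using assms unfolding inner_product_def
  by (cases "u = 0") (auto simp: less_imp_le)

lemma form_norm_nonneg:
  assumes "inner_product b"
  shows "form_norm b u \<ge> 0"
  using inner_product_nonneg[OF assms] by (simp add: form_norm_def)

lemma form_norm_power2:
  assumes "inner_product b"
  shows "(form_norm b u)\<^sup>2 = blinfun_apply (blinfun_apply b u) u"
  using inner_product_nonneg[OF assms] by (simp add: form_norm_def)

text \<open>Serves below to compare the norms of vectors that represent one covector in two
  metrics.\<close>

lemma form_norm_Cauchy_Schwarz:
  assumes b: "inner_product b"
  shows "blinfun_apply (blinfun_apply b u) v \<le> form_norm b u * form_norm b v"
proof (cases "v = 0")
  case True
  then show ?thesis by (simp add: form_norm_def blinfun.zero_right)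
next
  case False
  define B where "B u v = blinfun_apply (blinfun_apply b u) v" for u v
  have sym: "B v u = B u v" and pos: "B v v > 0"
    using b False unfolding inner_product_def B_def by auto
  \<comment> \<open>\<open>t *\<^sub>R v\<close> is the \<open>b\<close>-orthogonal projection of
    \<open>u\<close> onto \<open>v\<close>; this \<open>t\<close> minimises the form at
    \<open>u - t *\<^sub>R v\<close>, so nonnegativity there is exactly the desired bound.\<close>
  define t where "t = B u v / B v v"
  have "0 \<le> B (u - t *\<^sub>R v) (u - t *\<^sub>R v)"
    unfolding B_def by (rule inner_product_nonneg[OF b])
  also have "\<dots> = B u u - t * B u v - t * B v u + t * t * B v v"
    unfolding B_def
    by (simp add: blinfun.diff_left blinfun.diff_right blinfun.scaleR_left blinfun.scaleR_right
        algebra_simps)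
  also have "\<dots> = B u u - (B u v)\<^sup>2 / B v v"
    using pos by (simp add: sym t_def field_simps power2_eq_square)
  finally have "(B u v)\<^sup>2 \<le> B u u * B v v"
    using pos by (simp add: field_simps)
  then have "\<bar>B u v\<bar> \<le> sqrt (B u u * B v v)"
    by (metis real_sqrt_abs real_sqrt_le_mono)
  then show ?thesis
    by (simp add: B_def form_norm_def real_sqrt_mult)
qed

text \<open>The quadratic form attains its minimum on the compact unit sphere, where it is positive;
  homogeneity of degree two carries the bound to all vectors.\<close>

lemma inner_product_coercive:
  assumes b: "inner_product b"
  obtains m where "m > 0" "\<And>w. m * (norm w)\<^sup>2 \<le> blinfun_apply (blinfun_apply b w) w"
proof -
  let ?S = "sphere 0 1 :: (real ^ 'n) set"
  have "axis undefined 1 \<in> ?S" by simp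
  then have ne: "?S \<noteq> {}" by blast
  have cont: "continuous_on ?S (\<lambda>w. blinfun_apply (blinfun_apply b w) w)"
    by (intro continuous_intros)
  obtain w0 where w0: "w0 \<in> ?S"
    and min: "\<And>w. w \<in> ?S \<Longrightarrow>
      blinfun_apply (blinfun_apply b w0) w0 \<le> blinfun_apply (blinfun_apply b w) w"
    using continuous_attains_inf[OF compact_sphere ne cont] by blast
  define m where "m = blinfun_apply (blinfun_apply b w0) w0"
  have "w0 \<noteq> 0" using w0 by auto
  then have "m > 0" using b unfolding inner_product_def m_def by blast
  moreover have "m * (norm w)\<^sup>2 \<le> blinfun_apply (blinfun_apply b w) w" for w
  proof (cases "w = 0")
    case True
    then show ?thesis by (simp add: blinfun.zero_right)
  next
    case False
    then have "m \<le> blinfun_apply (blinfun_apply b (w /\<^sub>R norm w)) (w /\<^sub>R norm w)"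
      unfolding m_def by (intro min) simp
    also have "\<dots> = blinfun_apply (blinfun_apply b w) w / (norm w)\<^sup>2"
      by (simp add: blinfun.scaleR_left blinfun.scaleR_right field_simps power2_eq_square)
    finally show ?thesis using False by (simp add: field_simps)
  qed
  ultimately show ?thesis by (rule that)
qed

lemma bilinear_form_le_norm:
  fixes b :: "'n::finite bilinear_form"
  shows "\<bar>blinfun_apply (blinfun_apply b w) w\<bar> \<le> norm b * (norm w)\<^sup>2"
proof -
  have "norm (blinfun_apply (blinfun_apply b w) w) \<le> norm (blinfun_apply b w) * norm w"
    by (rule norm_blinfun)
  also have "\<dots> \<le> norm b * norm w * norm w"
    by (intro mult_right_mono norm_blinfun norm_ge_zero)
  finally show ?thesis by (simp add: power2_eq_square mult.assoc)
qed

text \<open>Closeness in operator norm controls the quadratic forms uniformly in \<open>w\<close>,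
  so near \<open>x\<close> the form of \<open>g\<close> is bounded above and that of
  \<open>g'\<close> below by fixed multiples of \<open>(norm w)\<^sup>2\<close>. One direction
  suffices, since the metrics can be swapped.\<close>

lemma C0_metrics_locally_equivalent:
  fixes g g' :: "real ^ 'n \<Rightarrow> 'n::finite bilinear_form"
  assumes g: "C0_metric_on X g" and g': "C0_metric_on X g'" and x: "x \<in> X"
  obtains K V where "K > 0" "openin (top_of_set X) V" "x \<in> V"
    "\<And>y w. y \<in> V \<Longrightarrow> form_norm (g y) w \<le> K * form_norm (g' y) w"
proof -
  have "inner_product (g' x)" using g' x unfolding C0_metric_on_def metric_on_def by blast
  then obtain m where m: "m > 0"
    and coercive: "\<And>w. m * (norm w)\<^sup>2 \<le> blinfun_apply (blinfun_apply (g' x) w) w"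
    by (rule inner_product_coercive) blast
  have "\<exists>e>0. \<forall>y\<in>X. dist y x < e \<longrightarrow> dist (g y) (g x) < 1"
    using g x zero_less_one unfolding C0_metric_on_def continuous_on_iff by blast
  then obtain e where e: "e > 0" "\<And>y. y \<in> X \<Longrightarrow> dist y x < e \<Longrightarrow> dist (g y) (g x) < 1"
    by blast
  \<comment> \<open>A perturbation below \<open>m / 2\<close> leaves half of the coercivity constant
    of \<open>g' x\<close>.\<close>
  have "\<exists>e>0. \<forall>y\<in>X. dist y x < e \<longrightarrow> dist (g' y) (g' x) < m / 2"
    using g' x half_gt_zero[OF m] unfolding C0_metric_on_def continuous_on_iff by blast
  then obtain e' where e': "e' > 0" "\<And>y. y \<in> X \<Longrightarrow> dist y x < e' \<Longrightarrow> dist (g' y) (g' x) < m / 2"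
    by blast
  define M where "M = norm (g x) + 1"
  have M: "M > 0" by (simp add: M_def add_nonneg_pos)
  \<comment> \<open>The ratio of the upper bound \<open>M\<close> for \<open>g\<close> to the lower
    bound \<open>m / 2\<close> for \<open>g'\<close>, with a root because norms are compared instead
    of forms.\<close>
  define K where "K = sqrt (M / (m / 2))"
  define V where "V = X \<inter> ball x (min e e')"
  show ?thesis
  proof (rule that)
    show "K > 0" using M m by (simp add: K_def)
    show "openin (top_of_set X) V" by (simp add: V_def openin_open_Int)
    show "x \<in> V" using x e e' by (simp add: V_def)
    fix y w assume "y \<in> V"
    then have y: "y \<in> X" "dist y x < e" "dist y x < e'" by (auto simp: V_def dist_commute)
    have "norm (g y) \<le> M"
      using e(2)[OF y(1,2)] norm_triangle_sub[of "g y" "g x"] by (simp add: M_def dist_norm)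
    then have upper: "blinfun_apply (blinfun_apply (g y) w) w \<le> M * (norm w)\<^sup>2"
      using bilinear_form_le_norm[of "g y" w] mult_right_mono[of "norm (g y)" M "(norm w)\<^sup>2"]
      by simp
    have "\<bar>blinfun_apply (blinfun_apply (g' y - g' x) w) w\<bar> \<le> m / 2 * (norm w)\<^sup>2"
      using bilinear_form_le_norm[of "g' y - g' x" w] e'(2)[OF y(1,3)]
        mult_right_mono[of "norm (g' y - g' x)" "m / 2" "(norm w)\<^sup>2"]
      by (simp add: dist_norm)
    then have lower: "m / 2 * (norm w)\<^sup>2 \<le> blinfun_apply (blinfun_apply (g' y) w) w"
      using coercive[of w] unfolding blinfun.diff_left by linarith
    have "M * (norm w)\<^sup>2 = M / (m / 2) * (m / 2 * (norm w)\<^sup>2)"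
      using m by simp
    also have "\<dots> \<le> M / (m / 2) * blinfun_apply (blinfun_apply (g' y) w) w"
      using lower M m by (intro mult_left_mono) auto
    finally have "blinfun_apply (blinfun_apply (g y) w) w
        \<le> M / (m / 2) * blinfun_apply (blinfun_apply (g' y) w) w"
      using upper by linarith
    then show "form_norm (g y) w \<le> K * form_norm (g' y) w"
      unfolding form_norm_def K_def real_sqrt_mult[symmetric] by (rule real_sqrt_le_mono)
  qed
qed

text \<open>Riesz representation: positive definiteness makes \<open>u \<mapsto> b u\<close>
  injective, and the dual has the same dimension, so the map is onto.\<close>

lemma inner_product_represents:
  fixes b :: "'n::finite bilinear_form" and \<phi> :: "(real ^ 'n) \<Rightarrow>\<^sub>L real"
  assumes b: "inner_product b"
  obtains \<eta> where "blinfun_apply b \<eta> = \<phi>"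
proof -
  \<comment> \<open>Recording \<open>b u\<close> by its values on the standard basis gives an
    endomorphism of \<open>real ^ 'n\<close>, for which injectivity implies surjectivity.\<close>
  define f where "f u = (\<chi> i. blinfun_apply (blinfun_apply b u) (axis i 1))" for u
  have ext: "\<psi> = \<psi>'"
    if "\<And>i. blinfun_apply \<psi> (axis i 1) = blinfun_apply \<psi>' (axis i 1)"
    for \<psi> \<psi>' :: "(real ^ 'n) \<Rightarrow>\<^sub>L real"
    using that by (intro blinfun_euclidean_eqI) (auto simp: Basis_vec_def)
  have lin: "linear f"
    by (rule linearI)
      (simp_all add: f_def vec_eq_iff blinfun.add_left blinfun.add_right
        blinfun.scaleR_left blinfun.scaleR_right)
  have "u = 0" if "f u = 0" for u
  proof (rule ccontr)
    assume "u \<noteq> 0"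
    have "blinfun_apply b u = 0"
      using that by (intro ext) (simp add: f_def vec_eq_iff)
    then show False
      using b \<open>u \<noteq> 0\<close> unfolding inner_product_def by (metis blinfun.zero_left less_irrefl)
  qed
  then have "surj f"
    using lin by (intro linear_injective_imp_surjective) (auto simp: linear_injective_0)
  then obtain \<eta> where "f \<eta> = (\<chi> i. blinfun_apply \<phi> (axis i 1))"
    by (metis surjD)
  then have "blinfun_apply b \<eta> = \<phi>"
    by (intro ext) (simp add: f_def vec_eq_iff)
  then show ?thesis by (rule that)
qed

theorem proposition6p6:
  fixes X :: "(real ^ 'n) set"
    and g g' :: "real ^ 'n \<Rightarrow> 'n::finite bilinear_form"
  assumes "clarke_regular X"
    and "C0_metric_on X g"
    and "prox_regular X g"
    and "C0_metric_on X g'"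
  shows "prox_regular X g'"
  unfolding prox_regular_def
proof (intro conjI ballI)
  show "clarke_regular X" by fact
next
  fix x assume x: "x \<in> X"
  obtain L U where L: "L > 0" and U: "openin (top_of_set X) U" "x \<in> U"
    and prox: "\<And>y z \<eta>. y \<in> U \<Longrightarrow> z \<in> U \<Longrightarrow> \<eta> \<in> normal_cone g X y \<Longrightarrow>
      blinfun_apply (blinfun_apply (g y) \<eta>) (z - y)
        \<le> L * form_norm (g y) \<eta> * (form_norm (g y) (z - y))\<^sup>2"
    using assms(3) x unfolding prox_regular_def by metis
  obtain K V where K: "K > 0" and V: "openin (top_of_set X) V" "x \<in> V"
    and le: "\<And>y w. y \<in> V \<Longrightarrow> form_norm (g y) w \<le> K * form_norm (g' y) w"
    using C0_metrics_locally_equivalent[OF assms(2,4) x] by metis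
  obtain K' V' where K': "K' > 0" and V': "openin (top_of_set X) V'" "x \<in> V'"
    and le': "\<And>y w. y \<in> V' \<Longrightarrow> form_norm (g' y) w \<le> K' * form_norm (g y) w"
    using C0_metrics_locally_equivalent[OF assms(4,2) x] by metis
  \<comment> \<open>In the new constant, \<open>K'\<close> pays for replacing the norm of the normal
    vector and \<open>K\<^sup>2\<close> for the squared length of \<open>z - y\<close>.\<close>
  have "blinfun_apply (blinfun_apply (g' y) \<eta>') (z - y)
      \<le> L * K' * K\<^sup>2 * form_norm (g' y) \<eta>' * (form_norm (g' y) (z - y))\<^sup>2"
    if y: "y \<in> U \<inter> V \<inter> V'" and z: "z \<in> U \<inter> V \<inter> V'" and \<eta>': "\<eta>' \<in> normal_cone g' X y"
    for y z \<eta>'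
  proof -
    have "y \<in> X" using y U(1) openin_imp_subset by blast
    then have gy: "inner_product (g y)" and g'y: "inner_product (g' y)"
      using assms(2,4) unfolding C0_metric_on_def metric_on_def by blast+
    obtain \<eta> where \<eta>: "blinfun_apply (g y) \<eta> = blinfun_apply (g' y) \<eta>'"
      using inner_product_represents[OF gy] by blast
    \<comment> \<open>Symmetry moves the normal vector to the second slot, as in
      \<open>normal_cone\<close>; the Clarke tangent cone is the same for both metrics.\<close>
    have "blinfun_apply (blinfun_apply (g y) v) \<eta> = blinfun_apply (blinfun_apply (g' y) v) \<eta>'" for v
      using gy g'y \<eta> unfolding inner_product_def by metis
    then have normal: "\<eta> \<in> normal_cone g X y"
      using \<eta>' by (simp add: normal_cone_def)
    \<comment> \<open>Pairing the common covector with \<open>\<eta>\<close> itself gives the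
      squared \<open>g\<close>-norm of \<open>\<eta>\<close>; Cauchy-Schwarz in \<open>g'\<close>
      then leaves one factor \<open>form_norm (g y) \<eta>\<close> to cancel.\<close>
    have "form_norm (g y) \<eta> * form_norm (g y) \<eta> = blinfun_apply (blinfun_apply (g' y) \<eta>') \<eta>"
      using form_norm_power2[OF gy, of \<eta>] \<eta> by (simp add: power2_eq_square)
    also have "\<dots> \<le> form_norm (g' y) \<eta>' * form_norm (g' y) \<eta>"
      by (rule form_norm_Cauchy_Schwarz[OF g'y])
    also have "\<dots> \<le> form_norm (g' y) \<eta>' * (K' * form_norm (g y) \<eta>)"
      using y by (intro mult_left_mono le' form_norm_nonneg g'y) auto
    finally have "form_norm (g y) \<eta> * form_norm (g y) \<eta>
        \<le> (K' * form_norm (g' y) \<eta>') * form_norm (g y) \<eta>"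
      by (simp add: algebra_simps)
    then have norm_\<eta>: "form_norm (g y) \<eta> \<le> K' * form_norm (g' y) \<eta>'"
      using form_norm_nonneg[OF gy, of \<eta>] form_norm_nonneg[OF g'y, of \<eta>'] K'
      by (cases "form_norm (g y) \<eta> = 0") auto
    have norm_z: "(form_norm (g y) (z - y))\<^sup>2 \<le> (K * form_norm (g' y) (z - y))\<^sup>2"
      using y by (intro power_mono le form_norm_nonneg gy) auto
    \<comment> \<open>The left side is the same number for both metrics by the choice of
      \<open>\<eta>\<close>, so only the norms on the right need converting.\<close>
    have "blinfun_apply (blinfun_apply (g' y) \<eta>') (z - y)
        \<le> L * form_norm (g y) \<eta> * (form_norm (g y) (z - y))\<^sup>2"
      using prox[of y z \<eta>] y z normal \<eta> by simp
    also have "\<dots> \<le> L * (K' * form_norm (g' y) \<eta>') * (K * form_norm (g' y) (z - y))\<^sup>2"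
      using L K' form_norm_nonneg[OF g'y]
      by (intro mult_mono norm_z mult_left_mono norm_\<eta>) auto
    finally show ?thesis by (simp add: power_mult_distrib mult_ac)
  qed
  moreover have "L * K' * K\<^sup>2 > 0" using L K K' by simp
  moreover have "openin (top_of_set X) (U \<inter> V \<inter> V')" using U V V' by (intro openin_Int)
  moreover have "x \<in> U \<inter> V \<inter> V'" using U V V' by simp
  ultimately show "\<exists>L>0. \<exists>U. openin (top_of_set X) U \<and> x \<in> U \<and>
      (\<forall>y\<in>U. \<forall>z\<in>U. \<forall>\<eta>\<in>normal_cone g' X y.
        blinfun_apply (blinfun_apply (g' y) \<eta>) (z - y)
          \<le> L * form_norm (g' y) \<eta> * (form_norm (g' y) (z - y))\<^sup>2)"
    by blast
qed

end
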